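(* Let $G$ be a finitely generated group with finite generating set $S$. If $G$ has seesaw elements of arbitrary swing with respect to $S$, then $G$ has infinitely many cone types with respect to $S$.
   Context: Let $|\cdot|$ be word length and $d$ the word metric in $G$ with respect to the finite generating set $S$. An element $w\in G$ is a seesaw element of swing $k$ with respect to a generator $g\in S$ if: (1) $|wg^{\pm1}|=|w|-1$, and $|wh^{\pm1}|\ge|w|$ for all $h\in S\smallsetminus\{g^{\pm1}\}$; (2) $|wg^{l}|=|wg^{l-1}|-1$ for all integers $l\in[1,k]$, and $|wg^{m}h^{\pm1}|\ge|wg^{m}|$ for all $h\in S\smallsetminus\{g^{\pm1}\}$ and all integers $m\in[1,k-1]$; (3) $|wg^{-l}|=|wg^{-l+1}|-1$ for all integers $l\in[1,k]$, and $|wg^{-m}h^{\pm1}|\ge|wg^{-m}|$ for all $h\in S\smallsetminus\{g^{\pm1}\}$ and all integers $m\in[1,k-1]$. "$G$ has seesaw elements of arbitrary swing with respect to $S$" means that for every positive integer $k$ there is an element of $G$ that is a seesaw element of swing $k$ with respect to some generator in $S$. A path $p$ in the Cayley graph is outbound if $d(1,p(s))$ is a strictly increasing function of $s$. The cone at $g\in G$ is the set $C'(g)$ of all outbound paths starting at $g$, and the cone type of $g$ is $C(g)=g^{-1}C'(g)$. (In the discrete setting, paths are edge paths, and $C(g)$ can be identified with the set of words $x_1\cdots x_n$ over $S\cup S^{-1}$ such that $d(1,gx_1\cdots x_i)=d(1,g)+i$ for all $1\le i\le n$.) *)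

theory Defs
  imports "HOL-Algebra.Generated_Groups"
begin

definition letters :: "('a, 'b) monoid_scheme \<Rightarrow> 'a set \<Rightarrow> 'a set" where
  "letters G S = S \<union> m_inv G ` S"

definition word_value :: "('a, 'b) monoid_scheme \<Rightarrow> 'a list \<Rightarrow> 'a" where
  "word_value G xs = foldr (mult G) xs \<one>\<^bsub>G\<^esub>"

text \<open>Meaningful when \<open>S\<close> generates \<open>G\<close>, so that every element is the value of some word.\<close>

definition word_length :: "('a, 'b) monoid_scheme \<Rightarrow> 'a set \<Rightarrow> 'a \<Rightarrow> nat" where
  "word_length G S x =
     (LEAST n. \<exists>xs. set xs \<subseteq> letters G S \<and> length xs = n \<and> word_value G xs = x)"

definition word_dist :: "('a, 'b) monoid_scheme \<Rightarrow> 'a set \<Rightarrow> 'a \<Rightarrow> 'a \<Rightarrow> nat" where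
  "word_dist G S x y = word_length G S (inv\<^bsub>G\<^esub> x \<otimes>\<^bsub>G\<^esub> y)"

text \<open>The exponents \<open>l\<close> and \<open>m\<close> are integers. Equations of the form \<open>|x| = |y| - 1\<close>
  are written \<open>|x| + 1 = |y|\<close>, since subtraction on naturals truncates.\<close>

definition seesaw :: "('a, 'b) monoid_scheme \<Rightarrow> 'a set \<Rightarrow> nat \<Rightarrow> 'a \<Rightarrow> 'a \<Rightarrow> bool" where
  "seesaw G S k g w \<longleftrightarrow>
     w \<in> carrier G \<and> g \<in> S \<and>
     (\<forall>x \<in> {g, inv\<^bsub>G\<^esub> g}. word_length G S (w \<otimes>\<^bsub>G\<^esub> x) + 1 = word_length G S w) \<and>
     (\<forall>h \<in> S - {g, inv\<^bsub>G\<^esub> g}. \<forall>x \<in> {h, inv\<^bsub>G\<^esub> h}.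
        word_length G S (w \<otimes>\<^bsub>G\<^esub> x) \<ge> word_length G S w) \<and>
     (\<forall>l::int. 1 \<le> l \<and> l \<le> int k \<longrightarrow>
        word_length G S (w \<otimes>\<^bsub>G\<^esub> g [^]\<^bsub>G\<^esub> l) + 1
          = word_length G S (w \<otimes>\<^bsub>G\<^esub> g [^]\<^bsub>G\<^esub> (l - 1))) \<and>
     (\<forall>h \<in> S - {g, inv\<^bsub>G\<^esub> g}. \<forall>m::int. 1 \<le> m \<and> m \<le> int k - 1 \<longrightarrow>
        (\<forall>x \<in> {h, inv\<^bsub>G\<^esub> h}.
          word_length G S (w \<otimes>\<^bsub>G\<^esub> g [^]\<^bsub>G\<^esub> m \<otimes>\<^bsub>G\<^esub> x)
            \<ge> word_length G S (w \<otimes>\<^bsub>G\<^esub> g [^]\<^bsub>G\<^esub> m))) \<and>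
     (\<forall>l::int. 1 \<le> l \<and> l \<le> int k \<longrightarrow>
        word_length G S (w \<otimes>\<^bsub>G\<^esub> g [^]\<^bsub>G\<^esub> (- l)) + 1
          = word_length G S (w \<otimes>\<^bsub>G\<^esub> g [^]\<^bsub>G\<^esub> (- l + 1))) \<and>
     (\<forall>h \<in> S - {g, inv\<^bsub>G\<^esub> g}. \<forall>m::int. 1 \<le> m \<and> m \<le> int k - 1 \<longrightarrow>
        (\<forall>x \<in> {h, inv\<^bsub>G\<^esub> h}.
          word_length G S (w \<otimes>\<^bsub>G\<^esub> g [^]\<^bsub>G\<^esub> (- m) \<otimes>\<^bsub>G\<^esub> x)
            \<ge> word_length G S (w \<otimes>\<^bsub>G\<^esub> g [^]\<^bsub>G\<^esub> (- m))))"

definition arbitrary_swing :: "('a, 'b) monoid_scheme \<Rightarrow> 'a set \<Rightarrow> bool" where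
  "arbitrary_swing G S \<longleftrightarrow> (\<forall>k>0. \<exists>w g. seesaw G S k g w)"

text \<open>Edge paths in the Cayley graph, given by their nonempty list of vertices; an edge joins
  \<open>x\<close> to \<open>x s\<close> for each letter \<open>s\<close>, so left translations act on edge paths.\<close>

definition edge_path :: "('a, 'b) monoid_scheme \<Rightarrow> 'a set \<Rightarrow> 'a list \<Rightarrow> bool" where
  "edge_path G S p \<longleftrightarrow> p \<noteq> [] \<and> set p \<subseteq> carrier G \<and>
     successively (\<lambda>x y. \<exists>s \<in> letters G S. y = x \<otimes>\<^bsub>G\<^esub> s) p"

definition outbound :: "('a, 'b) monoid_scheme \<Rightarrow> 'a set \<Rightarrow> 'a list \<Rightarrow> bool" where
  "outbound G S p \<longleftrightarrow> edge_path G S p \<and>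
     sorted_wrt (<) (map (word_dist G S \<one>\<^bsub>G\<^esub>) p)"

definition cone :: "('a, 'b) monoid_scheme \<Rightarrow> 'a set \<Rightarrow> 'a \<Rightarrow> 'a list set" where
  "cone G S g = {p. outbound G S p \<and> hd p = g}"

definition cone_type :: "('a, 'b) monoid_scheme \<Rightarrow> 'a set \<Rightarrow> 'a \<Rightarrow> 'a list set" where
  "cone_type G S g = map (mult G (inv\<^bsub>G\<^esub> g)) ` cone G S g"

end

theory Submission
  imports Defs
begin

text \<open>If \<open>w\<close> is a seesaw element of swing \<open>k\<close> with respect to \<open>g\<close>, then from \<open>w g\<^sup>-\<^sup>i\<close> with
  \<open>i \<le> k\<close> the ray \<open>1, g, g\<^sup>2, \<dots>\<close> is outbound for exactly \<open>i\<close> steps: it climbs up to \<open>w\<close>, and the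
  next step to \<open>w g\<close> descends. Hence these \<open>k + 1\<close> elements have pairwise different cone types.\<close>

text \<open>Translations by \<open>x\<close> and \<open>inv x\<close> undo each other on lists over
  the carrier, so membership in a cone type can be tested back at \<open>x\<close>, where lengths
  are measured.\<close>

lemma (in group) mem_cone_type_iff:
  assumes "x \<in> carrier G" "set p \<subseteq> carrier G"
  shows "p \<in> cone_type G S x \<longleftrightarrow> map (mult G x) p \<in> cone G S x"
proof
  assume "p \<in> cone_type G S x"
  then obtain q where q: "q \<in> cone G S x" "p = map (mult G (inv x)) q"
    by (auto simp: cone_type_def)
  then have "set q \<subseteq> carrier G"
    by (simp add: cone_def outbound_def edge_path_def)
  then have "map (mult G x) p = q"
    using assms(1) by (auto simp: q(2) m_assoc[symmetric] intro!: map_idI)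
  then show "map (mult G x) p \<in> cone G S x"
    using q(1) by simp
next
  assume *: "map (mult G x) p \<in> cone G S x"
  have "p = map (mult G (inv x)) (map (mult G x) p)"
    using assms by (auto simp: m_assoc[symmetric] intro!: map_idI[symmetric])
  then show "p \<in> cone_type G S x"
    using * unfolding cone_type_def by blast
qed

text \<open>The translated power path is always an edge path starting at \<open>x\<close>, so only
  the growth of lengths remains. By transitivity of \<open><\<close> it suffices to compare
  consecutive vertices; \<open>Suc j\<close> vertices make \<open>j\<close> steps.\<close>

lemma (in group) power_path_mem_cone_type_iff:
  assumes x: "x \<in> carrier G" and g: "g \<in> carrier G" "g \<in> S"
  shows "map (\<lambda>m. g [^] m) [0..<Suc j] \<in> cone_type G S x \<longleftrightarrow>
    (\<forall>m<j. word_length G S (x \<otimes> g [^] m) < word_length G S (x \<otimes> g [^] Suc m))"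
proof -
  let ?q = "map (\<lambda>m. x \<otimes> g [^] m) [0..<Suc j]"
  have "\<forall>m<j. \<exists>s\<in>letters G S. x \<otimes> g [^] Suc m = x \<otimes> g [^] m \<otimes> s"
    using x g by (auto simp: letters_def m_assoc intro!: bexI[of _ g])
  then have "edge_path G S ?q"
    using x g by (auto simp: edge_path_def successively_conv_nth nth_append simp del: upt_Suc)
  moreover have "hd ?q = x"
    using x by (simp add: hd_map del: upt_Suc)
  moreover have "sorted_wrt (<) (map (word_dist G S \<one>) ?q) \<longleftrightarrow>
      (\<forall>m<j. word_length G S (x \<otimes> g [^] m) < word_length G S (x \<otimes> g [^] Suc m))"
    using x g(1) by (simp add: sorted_wrt_iff_nth_Suc_transp word_dist_def del: upt_Suc nat_pow_Suc)
  ultimately have "?q \<in> cone G S x \<longleftrightarrow>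
      (\<forall>m<j. word_length G S (x \<otimes> g [^] m) < word_length G S (x \<otimes> g [^] Suc m))"
    by (simp add: cone_def outbound_def del: upt_Suc nat_pow_Suc)
  moreover have "map (mult G x) (map (\<lambda>m. g [^] m) [0..<Suc j]) = ?q"
    by simp
  moreover have "set (map (\<lambda>m. g [^] m) [0..<Suc j]) \<subseteq> carrier G"
    using g(1) by auto
  ultimately show ?thesis
    using mem_cone_type_iff[OF x] by metis
qed

lemma (in group) seesaw_inj_on_cone_type:
  assumes S: "S \<subseteq> carrier G" and w: "seesaw G S k g w"
  shows "inj_on (\<lambda>i. cone_type G S (w \<otimes> g [^] (- int i))) {..k}"
proof (rule linorder_inj_onI')
  fix i j assume ij: "i \<in> {..k}" "j \<in> {..k}" "i < j"
  have g: "g \<in> carrier G" "g \<in> S" and wc: "w \<in> carrier G"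
    using S w by (auto simp: seesaw_def)
  \<comment> \<open>Paths carry natural exponents, the seesaw conditions integer ones. In the merged
    exponent, the path reaches \<open>w\<close> exactly at \<open>m = i\<close>.\<close>
  have shift: "w \<otimes> g [^] (- int i) \<otimes> g [^] m = w \<otimes> g [^] (int m - int i)" for i m :: nat
  proof -
    have "g [^] (- int i) \<otimes> g [^] m = g [^] (- int i + int m)"
      using g by (simp only: int_pow_mult int_pow_int)
    then show ?thesis
      using g wc by (simp add: m_assoc)
  qed
  have mem_iff: "map (\<lambda>m. g [^] m) [0..<Suc j] \<in> cone_type G S (w \<otimes> g [^] (- int i)) \<longleftrightarrow>
      (\<forall>m<j. word_length G S (w \<otimes> g [^] (int m - int i))
        < word_length G S (w \<otimes> g [^] (int (Suc m) - int i)))" for i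
    using g wc by (simp only: power_path_mem_cone_type_iff shift m_closed int_pow_closed)
  \<comment> \<open>The path with \<open>j\<close> steps separates the two types: started at the
    \<open>j\<close>-th point it ends at \<open>w\<close>, started at the \<open>i\<close>-th it
    runs past \<open>w\<close>.\<close>
  have "map (\<lambda>m. g [^] m) [0..<Suc j] \<in> cone_type G S (w \<otimes> g [^] (- int j))"
    unfolding mem_iff
  proof (intro allI impI)
    fix m assume "m < j"
    \<comment> \<open>Swing condition (3) is used with \<open>l = j - m\<close>, which lies in its
      range because \<open>m < j \<le> k\<close>.\<close>
    then have "1 \<le> int j - int m" "int j - int m \<le> int k"
      using ij by auto
    then have "word_length G S (w \<otimes> g [^] (- (int j - int m))) + 1
        = word_length G S (w \<otimes> g [^] (- (int j - int m) + 1))"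
      using w unfolding seesaw_def by blast
    moreover have "- (int j - int m) = int m - int j" "int m - int j + 1 = int (Suc m) - int j"
      by simp_all
    ultimately show "word_length G S (w \<otimes> g [^] (int m - int j))
        < word_length G S (w \<otimes> g [^] (int (Suc m) - int j))"
      by (metis less_add_one)
  qed
  moreover have "map (\<lambda>m. g [^] m) [0..<Suc j] \<notin> cone_type G S (w \<otimes> g [^] (- int i))"
  proof -
    \<comment> \<open>The step with index \<open>i < j\<close> leads from \<open>w\<close> to
      \<open>w \<otimes> g\<close>, and condition (1) makes it descend.\<close>
    have "word_length G S (w \<otimes> g) + 1 = word_length G S w"
      using w unfolding seesaw_def by blast
    moreover have "g [^] (1::int) = g" "g [^] (0::int) = \<one>"
      using g by (simp_all add: int_pow_1)
    ultimately have "\<not> word_length G S (w \<otimes> g [^] (int i - int i))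
        < word_length G S (w \<otimes> g [^] (int (Suc i) - int i))"
      using wc by simp
    then show ?thesis
      unfolding mem_iff using ij(3) by blast
  qed
  ultimately show "cone_type G S (w \<otimes> g [^] (- int i)) \<noteq> cone_type G S (w \<otimes> g [^] (- int j))"
    by metis
qed

theorem corollary31:
  fixes G :: "('a, 'b) monoid_scheme" and S :: "'a set"
  assumes "group G"
    and "finite S" and "S \<subseteq> carrier G" and "generate G S = carrier G"
    and "arbitrary_swing G S"
  shows "infinite (cone_type G S ` carrier G)"
proof
  interpret group G by fact
  assume fin: "finite (cone_type G S ` carrier G)"
  \<comment> \<open>The successor makes the swing positive. With \<open>n\<close> cone types, the
    indices \<open>{..?k}\<close> would give \<open>n + 2\<close> distinct ones.\<close>
  let ?k = "Suc (card (cone_type G S ` carrier G))"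
  obtain w g where w: "seesaw G S ?k g w"
    using assms(5) unfolding arbitrary_swing_def by blast
  have "w \<in> carrier G" "g \<in> carrier G"
    using w assms(3) by (auto simp: seesaw_def)
  then have "(\<lambda>i. cone_type G S (w \<otimes>\<^bsub>G\<^esub> g [^]\<^bsub>G\<^esub> (- int i))) ` {..?k}
      \<subseteq> cone_type G S ` carrier G"
    by auto
  from card_inj_on_le[OF seesaw_inj_on_cone_type[OF assms(3) w] this fin]
  show False
    by simp
qed

end
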